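(* Let $\mathbf{k}$ be a commutative unital ring, $n\ge 1$, and let $L\in M_n(\mathbf{k})$ satisfy $L^2=0$. Let $\mathfrak{m}$ be matrix multiplication, $E$ the identity matrix, and define $$\Delta_L:M_n(\mathbf{k})\to M_n(\mathbf{k})\otimes M_n(\mathbf{k}),\qquad \Delta_L(M)=ML\otimes L-L\otimes LM.$$ Then $(M_n(\mathbf{k}),\mathfrak{m},E,\Delta_L)$ is an infinitesimal unitary bialgebra of weight zero.
   Context: Tensor products are over $\mathbf{k}$. For an associative algebra $A$, $A\otimes A$ is an $A$-bimodule via $a\cdot(b\otimes c)=ab\otimes c$ and $(b\otimes c)\cdot a=b\otimes ca$. For $\lambda\in\mathbf{k}$, an infinitesimal unitary bialgebra of weight $\lambda$ is a quadruple $(A,m,1,\Delta)$ where $(A,m,1)$ is a unital associative $\mathbf{k}$-algebra and $\Delta:A\to A\otimes A$ is a coassociative linear map (no counit is required) such that $\Delta(ab)=a\cdot\Delta(b)+\Delta(a)\cdot b+\lambda(a\otimes b)$ for all $a,b\in A$. *)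

theory Defs
  imports "Jordan_Normal_Form.VS_Connect" "HOL-Algebra.Free_Abelian_Groups"
begin

section \<open>Tensor products of modules over a commutative ring\<close>

text \<open>
  The tensor product of \<open>M\<close> and \<open>N\<close> over \<open>R\<close> is the free abelian group on
  \<open>carrier M \<times> carrier N\<close> modulo the subgroup generated by the elements that express
  biadditivity and \<open>R\<close>-balancedness. Its elements are cosets, i.e. sets of formal sums.
\<close>

definition tensor_relators ::
    "('r, 'x) ring_scheme \<Rightarrow> ('r, 'a, 'y) module_scheme \<Rightarrow> ('r, 'b, 'z) module_scheme
      \<Rightarrow> ('a \<times> 'b \<Rightarrow>\<^sub>0 int) set"
  where "tensor_relators R M N =
    {frag_of (x \<oplus>\<^bsub>M\<^esub> x', y) - frag_of (x, y) - frag_of (x', y) | x x' y.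
       x \<in> carrier M \<and> x' \<in> carrier M \<and> y \<in> carrier N} \<union>
    {frag_of (x, y \<oplus>\<^bsub>N\<^esub> y') - frag_of (x, y) - frag_of (x, y') | x y y'.
       x \<in> carrier M \<and> y \<in> carrier N \<and> y' \<in> carrier N} \<union>
    {frag_of (r \<odot>\<^bsub>M\<^esub> x, y) - frag_of (x, r \<odot>\<^bsub>N\<^esub> y) | r x y.
       r \<in> carrier R \<and> x \<in> carrier M \<and> y \<in> carrier N}"

abbreviation tensor_free ::
    "('r, 'a, 'y) module_scheme \<Rightarrow> ('r, 'b, 'z) module_scheme \<Rightarrow> ('a \<times> 'b \<Rightarrow>\<^sub>0 int) monoid"
  where "tensor_free M N \<equiv> free_Abelian_group (carrier M \<times> carrier N)"

definition tensor_null ::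
    "('r, 'x) ring_scheme \<Rightarrow> ('r, 'a, 'y) module_scheme \<Rightarrow> ('r, 'b, 'z) module_scheme
      \<Rightarrow> ('a \<times> 'b \<Rightarrow>\<^sub>0 int) set"
  where "tensor_null R M N = generate (tensor_free M N) (tensor_relators R M N)"

definition pure_tensor ::
    "('r, 'x) ring_scheme \<Rightarrow> ('r, 'a, 'y) module_scheme \<Rightarrow> ('r, 'b, 'z) module_scheme
      \<Rightarrow> 'a \<Rightarrow> 'b \<Rightarrow> ('a \<times> 'b \<Rightarrow>\<^sub>0 int) set"
  where "pure_tensor R M N x y = tensor_null R M N #>\<^bsub>tensor_free M N\<^esub> frag_of (x, y)"

text \<open>
  Scalars act by \<open>r \<odot> (x \<otimes> y) = (r \<odot> x) \<otimes> y\<close>. The record type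
  \<^typ>\<open>('r, 'a) module\<close> also has fields for a multiplication and a unit, which play no role
  for modules and are left unspecified here.
\<close>

definition tensor_product ::
    "('r, 'x) ring_scheme \<Rightarrow> ('r, 'a, 'y) module_scheme \<Rightarrow> ('r, 'b, 'z) module_scheme
      \<Rightarrow> ('r, ('a \<times> 'b \<Rightarrow>\<^sub>0 int) set) module"
  where "tensor_product R M N =
    (let Q = tensor_free M N Mod tensor_null R M N in
     \<lparr>carrier = carrier Q,
      monoid.mult = undefined,
      monoid.one = undefined,
      ring.zero = \<one>\<^bsub>Q\<^esub>,
      ring.add = monoid.mult Q,
      smult = (\<lambda>r X. \<Union>c\<in>X. tensor_null R M N #>\<^bsub>tensor_free M N\<^esub>
                 frag_extend (\<lambda>(x, y). frag_of (r \<odot>\<^bsub>M\<^esub> x, y)) c)\<rparr>)"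

text \<open>
  \<open>tensor_lift P \<phi>\<close> is the additive map on a tensor product with values in \<open>P\<close> that sends
  \<open>x \<otimes> y\<close> to \<open>\<phi> x y\<close>. It is meaningful only for biadditive and balanced \<open>\<phi>\<close>:
  in that case all representatives \<open>c\<close> of a coset have the same value, which
  \<^const>\<open>the_elem\<close> extracts.
\<close>

definition tensor_lift ::
    "('c, 'w) ring_scheme \<Rightarrow> ('a \<Rightarrow> 'b \<Rightarrow> 'c) \<Rightarrow> ('a \<times> 'b \<Rightarrow>\<^sub>0 int) set \<Rightarrow> 'c"
  where "tensor_lift P \<phi> X =
    the_elem ((\<lambda>c. \<Oplus>\<^bsub>P\<^esub>z\<in>Poly_Mapping.keys c.
                 [Poly_Mapping.lookup c z] \<cdot>\<^bsub>P\<^esub> \<phi> (fst z) (snd z)) ` X)"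

text \<open>The map \<open>f \<otimes> g: M \<otimes> N \<rightarrow> M' \<otimes> N'\<close> (only the target modules are needed).\<close>

definition tensor_map ::
    "('r, 'x) ring_scheme \<Rightarrow> ('r, 'c, 'y) module_scheme \<Rightarrow> ('r, 'd, 'z) module_scheme
      \<Rightarrow> ('a \<Rightarrow> 'c) \<Rightarrow> ('b \<Rightarrow> 'd)
      \<Rightarrow> ('a \<times> 'b \<Rightarrow>\<^sub>0 int) set \<Rightarrow> ('c \<times> 'd \<Rightarrow>\<^sub>0 int) set"
  where "tensor_map R M' N' f g =
    tensor_lift (tensor_product R M' N') (\<lambda>x y. pure_tensor R M' N' (f x) (g y))"

text \<open>The canonical map
  \<open>(M \<otimes> N) \<otimes> P \<rightarrow> M \<otimes> (N \<otimes> P)\<close>, \<open>(x \<otimes> y) \<otimes> z \<mapsto> x \<otimes> (y \<otimes> z)\<close>.\<close>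

definition tensor_assoc ::
    "('r, 'x) ring_scheme \<Rightarrow> ('r, 'a, 'u) module_scheme \<Rightarrow> ('r, 'b, 'v) module_scheme
      \<Rightarrow> ('r, 'c, 'w) module_scheme
      \<Rightarrow> (('a \<times> 'b \<Rightarrow>\<^sub>0 int) set \<times> 'c \<Rightarrow>\<^sub>0 int) set
      \<Rightarrow> ('a \<times> ('b \<times> 'c \<Rightarrow>\<^sub>0 int) set \<Rightarrow>\<^sub>0 int) set"
  where "tensor_assoc R M N P =
    (let NP = tensor_product R N P; T = tensor_product R M NP in
     tensor_lift T (\<lambda>X z. tensor_lift T (\<lambda>x y. pure_tensor R M NP x (pure_tensor R N P y z)) X))"


section \<open>Infinitesimal unitary bialgebras\<close>

text \<open>The library locale \<^locale>\<open>algebra\<close> is not used because it requires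
  a commutative multiplication.\<close>

locale unital_assoc_algebra = Module.module R A + ring A
  for R (structure) and A (structure) +
  assumes smult_mult_left: "\<lbrakk>r \<in> carrier R; a \<in> carrier A; b \<in> carrier A\<rbrakk> \<Longrightarrow>
      (r \<odot>\<^bsub>A\<^esub> a) \<otimes>\<^bsub>A\<^esub> b = r \<odot>\<^bsub>A\<^esub> (a \<otimes>\<^bsub>A\<^esub> b)"
    and smult_mult_right: "\<lbrakk>r \<in> carrier R; a \<in> carrier A; b \<in> carrier A\<rbrakk> \<Longrightarrow>
      a \<otimes>\<^bsub>A\<^esub> (r \<odot>\<^bsub>A\<^esub> b) = r \<odot>\<^bsub>A\<^esub> (a \<otimes>\<^bsub>A\<^esub> b)"

text \<open>The \<open>A\<close>-bimodule structure of \<open>A \<otimes> A\<close>: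
  \<open>a \<cdot> (b \<otimes> c) = ab \<otimes> c\<close> and \<open>(b \<otimes> c) \<cdot> a = b \<otimes> ca\<close>.\<close>

definition tensor_left_act ::
    "('r, 'x) ring_scheme \<Rightarrow> ('r, 'a, 'y) module_scheme
      \<Rightarrow> 'a \<Rightarrow> ('a \<times> 'a \<Rightarrow>\<^sub>0 int) set \<Rightarrow> ('a \<times> 'a \<Rightarrow>\<^sub>0 int) set"
  where "tensor_left_act R A a = tensor_map R A A (\<lambda>b. a \<otimes>\<^bsub>A\<^esub> b) (\<lambda>c. c)"

definition tensor_right_act ::
    "('r, 'x) ring_scheme \<Rightarrow> ('r, 'a, 'y) module_scheme
      \<Rightarrow> ('a \<times> 'a \<Rightarrow>\<^sub>0 int) set \<Rightarrow> 'a \<Rightarrow> ('a \<times> 'a \<Rightarrow>\<^sub>0 int) set"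
  where "tensor_right_act R A X a = tensor_map R A A (\<lambda>b. b) (\<lambda>c. c \<otimes>\<^bsub>A\<^esub> a) X"

text \<open>The multiplication and the unit of the algebra are fields of the record \<open>A\<close>.\<close>

locale infinitesimal_unitary_bialgebra = unital_assoc_algebra R A
  for R (structure) and A (structure) and weight and \<Delta> +
  assumes weight_closed: "weight \<in> carrier R"
    and coproduct_linear: "\<Delta> \<in> LinearCombinations.module_hom R A (tensor_product R A A)"
    and coassoc: "a \<in> carrier A \<Longrightarrow>
      tensor_assoc R A A A (tensor_map R (tensor_product R A A) A \<Delta> (\<lambda>x. x) (\<Delta> a)) =
      tensor_map R A (tensor_product R A A) (\<lambda>x. x) \<Delta> (\<Delta> a)"
    and coproduct_mult: "\<lbrakk>a \<in> carrier A; b \<in> carrier A\<rbrakk> \<Longrightarrow>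
      \<Delta> (a \<otimes>\<^bsub>A\<^esub> b) =
        tensor_left_act R A a (\<Delta> b)
        \<oplus>\<^bsub>tensor_product R A A\<^esub> tensor_right_act R A (\<Delta> a) b
        \<oplus>\<^bsub>tensor_product R A A\<^esub> weight \<odot>\<^bsub>tensor_product R A A\<^esub> pure_tensor R A A a b"


section \<open>Matrix algebras\<close>

text \<open>
  The sort \<open>{comm_ring, comm_monoid_mult}\<close> consists of all commutative unital rings;
  unlike \<^class>\<open>comm_ring_1\<close> it does not exclude the zero ring. For this reason the record
  below is used instead of \<^const>\<open>module_mat\<close>, whose fields it repeats.
\<close>

definition mat_algebra :: "nat \<Rightarrow> ('k :: {comm_ring, comm_monoid_mult}, 'k mat) module"
  where "mat_algebra n =
    \<lparr>carrier = carrier_mat n n,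
     monoid.mult = (*),
     monoid.one = 1\<^sub>m n,
     ring.zero = 0\<^sub>m n n,
     ring.add = (+),
     smult = (\<cdot>\<^sub>m)\<rparr>"

abbreviation mat_tensor ::
    "nat \<Rightarrow> 'k :: {comm_ring, comm_monoid_mult} mat \<Rightarrow> 'k mat \<Rightarrow> ('k mat \<times> 'k mat \<Rightarrow>\<^sub>0 int) set"
  where "mat_tensor n \<equiv> pure_tensor class_ring (mat_algebra n) (mat_algebra n)"

definition mat_coproduct ::
    "nat \<Rightarrow> 'k :: {comm_ring, comm_monoid_mult} mat \<Rightarrow> 'k mat \<Rightarrow> ('k mat \<times> 'k mat \<Rightarrow>\<^sub>0 int) set"
  where "mat_coproduct n L M =
    mat_tensor n (M * L) L
    \<ominus>\<^bsub>tensor_product class_ring (mat_algebra n) (mat_algebra n)\<^esub> mat_tensor n L (L * M)"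

end

theory Submission
  imports Defs
begin

text \<open>
  The argument works in any unital associative algebra for an element \<open>L\<close> with \<open>L\<^sup>2 = 0\<close>.
  In the Leibniz rule the two mixed terms \<open>aL \<otimes> Lb\<close> cancel. In the coassociativity law all
  terms containing \<open>L\<^sup>2\<close> vanish, and both sides reduce to \<open>- L \<otimes> LaL \<otimes> L\<close>.
  The tensor products only enter through their universal property, which makes maps
  well defined on cosets of formal sums, and through induction from pure tensors to sums.
\<close>

section \<open>The tensor product as a module\<close>

lemma keys_add_subset: "Poly_Mapping.keys a \<subseteq> S \<Longrightarrow> Poly_Mapping.keys b \<subseteq> S \<Longrightarrow> Poly_Mapping.keys (a + b) \<subseteq> S"
  using Poly_Mapping.keys_add[of a b] by blast

lemma keys_diff_subset: "Poly_Mapping.keys a \<subseteq> S \<Longrightarrow> Poly_Mapping.keys b \<subseteq> S \<Longrightarrow> Poly_Mapping.keys (a - b) \<subseteq> S"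
  for a b :: "'a \<Rightarrow>\<^sub>0 int"
  using keys_diff[of a b] by blast

text \<open>Regroups the four terms that arise when a sum of two additive maps is evaluated at a
  sum.\<close>

lemma (in abelian_group) add_swap:
  "a \<in> carrier G \<Longrightarrow> b \<in> carrier G \<Longrightarrow> c \<in> carrier G \<Longrightarrow> d \<in> carrier G \<Longrightarrow>
    (a \<oplus> b) \<oplus> (c \<oplus> d) = (a \<oplus> c) \<oplus> (b \<oplus> d)"
  by (simp add: a_ac)

locale tensor_modules = M: Module.module R M + N: Module.module R N
  for R (structure) and M and N
begin

abbreviation free where "free \<equiv> tensor_free M N"
abbreviation null where "null \<equiv> tensor_null R M N"
abbreviation cos where "cos c \<equiv> null #>\<^bsub>free\<^esub> c"
abbreviation MN where "MN \<equiv> tensor_product R M N"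
abbreviation pure where "pure \<equiv> pure_tensor R M N"

section \<open>Cosets of formal sums\<close>

lemma relators_closed: "tensor_relators R M N \<subseteq> carrier free"
  unfolding tensor_relators_def
  by (rule subsetI, elim UnE CollectE exE conjE; simp; (intro keys_diff_subset)?; simp)

lemma null_subgroup: "subgroup null free"
  unfolding tensor_null_def
  by (rule group.generate_is_subgroup[OF group_free_Abelian_group relators_closed])

sublocale null: normal null free
  using comm_group.subgroup_imp_normal[OF abelian_free_Abelian_group null_subgroup]
  by simp

lemma relators_null: "c \<in> tensor_relators R M N \<Longrightarrow> c \<in> null"
  unfolding tensor_null_def by (rule generate.incl)

lemma cos_eqI:
  assumes "c - d \<in> null" "Poly_Mapping.keys c \<subseteq> carrier M \<times> carrier N"
    "Poly_Mapping.keys d \<subseteq> carrier M \<times> carrier N"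
  shows "cos c = cos d"
proof -
  have "c \<in> cos d"
    unfolding r_coset_def using assms by (auto intro!: bexI[of _ "c - d"])
  then show ?thesis
    using group.repr_independence[OF group_free_Abelian_group _ _ null_subgroup, of c d] assms
    by simp
qed

text \<open>The condition on \<open>Poly_Mapping.keys\<close> is the form into which the simplifier
  rewrites membership in the free abelian group, so later proofs can choose a representative and
  compute with it.\<close>

lemma carrier_tensor: "carrier MN = cos ` {c. Poly_Mapping.keys c \<subseteq> carrier M \<times> carrier N}"
proof -
  have "carrier free = {c. Poly_Mapping.keys c \<subseteq> carrier M \<times> carrier N}" by auto
  then show ?thesis by (simp add: tensor_product_def Let_def carrier_FactGroup)
qed

lemma add_cos:
  assumes "Poly_Mapping.keys c \<subseteq> carrier M \<times> carrier N" "Poly_Mapping.keys d \<subseteq> carrier M \<times> carrier N"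
  shows "cos c \<oplus>\<^bsub>MN\<^esub> cos d = cos (c + d)"
  using null.rcos_sum[of c d] assms by (simp add: tensor_product_def Let_def)

lemma abelian_group_tensor: "abelian_group MN"
proof -
  interpret Q: comm_group "free Mod null"
    by (rule comm_group.abelian_FactGroup[OF abelian_free_Abelian_group null_subgroup])
  have "comm_group (add_monoid MN)"
    \<comment> \<open>Addition of \<open>MN\<close> is the operation of the quotient group. The two
      \<open>FactGroup\<close> rules are kept out so that the goals stay in terms of
      \<open>free Mod null\<close> and match the axioms of \<open>Q\<close>.\<close>
    by (rule comm_groupI; simp add: tensor_product_def Let_def del: mult_FactGroup one_FactGroup)
       (assumption | rule Q.m_assoc Q.m_comm Q.l_inv_ex)+
  then show ?thesis by (rule comm_group_abelian_groupI)
qed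

sublocale T: abelian_group MN by (rule abelian_group_tensor)

section \<open>Bilinearity of pure tensors and induction on sums\<close>

lemma pure_closed [simp, intro]:
  "x \<in> carrier M \<Longrightarrow> y \<in> carrier N \<Longrightarrow> pure x y \<in> carrier MN"
  unfolding pure_tensor_def carrier_tensor by auto

lemma pure_add_left:
  assumes "x \<in> carrier M" "x' \<in> carrier M" "y \<in> carrier N"
  shows "pure (x \<oplus>\<^bsub>M\<^esub> x') y = pure x y \<oplus>\<^bsub>MN\<^esub> pure x' y"
proof -
  have "frag_of (x \<oplus>\<^bsub>M\<^esub> x', y) - (frag_of (x, y) + frag_of (x', y)) \<in> null"
    by (rule relators_null) (use assms in \<open>auto simp: tensor_relators_def diff_diff_eq\<close>)
  moreover have "Poly_Mapping.keys (frag_of (x, y) + frag_of (x', y)) \<subseteq> carrier M \<times> carrier N"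
    using keys_add[of "frag_of (x, y)" "frag_of (x', y)"] assms by auto
  ultimately show ?thesis
    unfolding pure_tensor_def using assms by (simp add: add_cos) (rule cos_eqI; simp)
qed

lemma pure_add_right:
  assumes "x \<in> carrier M" "y \<in> carrier N" "y' \<in> carrier N"
  shows "pure x (y \<oplus>\<^bsub>N\<^esub> y') = pure x y \<oplus>\<^bsub>MN\<^esub> pure x y'"
proof -
  have "frag_of (x, y \<oplus>\<^bsub>N\<^esub> y') - (frag_of (x, y) + frag_of (x, y')) \<in> null"
    by (rule relators_null) (use assms in \<open>auto simp: tensor_relators_def diff_diff_eq\<close>)
  moreover have "Poly_Mapping.keys (frag_of (x, y) + frag_of (x, y')) \<subseteq> carrier M \<times> carrier N"
    using keys_add[of "frag_of (x, y)" "frag_of (x, y')"] assms by auto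
  ultimately show ?thesis
    unfolding pure_tensor_def using assms by (simp add: add_cos) (rule cos_eqI; simp)
qed

lemma pure_smult_left:
  assumes "r \<in> carrier R" "x \<in> carrier M" "y \<in> carrier N"
  shows "pure (r \<odot>\<^bsub>M\<^esub> x) y = pure x (r \<odot>\<^bsub>N\<^esub> y)"
  unfolding pure_tensor_def
  by (rule cos_eqI, rule relators_null) (use assms in \<open>auto simp: tensor_relators_def\<close>)

text \<open>Additivity at zero gives \<open>u = u \<oplus> u\<close>, and cancellation leaves
  \<open>u\<close> equal to zero.\<close>

lemma pure_zero_left [simp]:
  assumes "y \<in> carrier N"
  shows "pure \<zero>\<^bsub>M\<^esub> y = \<zero>\<^bsub>MN\<^esub>"
  using pure_add_left[of "\<zero>\<^bsub>M\<^esub>" "\<zero>\<^bsub>M\<^esub>" y] assms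
  by (simp add: T.add.r_cancel_one')

lemma pure_zero_right [simp]:
  assumes "x \<in> carrier M"
  shows "pure x \<zero>\<^bsub>N\<^esub> = \<zero>\<^bsub>MN\<^esub>"
  using pure_add_right[of x "\<zero>\<^bsub>N\<^esub>" "\<zero>\<^bsub>N\<^esub>"] assms
  by (simp add: T.add.r_cancel_one')

lemma pure_minus_left:
  assumes "x \<in> carrier M" "y \<in> carrier N"
  shows "pure (\<ominus>\<^bsub>M\<^esub> x) y = \<ominus>\<^bsub>MN\<^esub> pure x y"
proof (rule T.minus_equality[symmetric])
  show "pure (\<ominus>\<^bsub>M\<^esub> x) y \<oplus>\<^bsub>MN\<^esub> pure x y = \<zero>\<^bsub>MN\<^esub>"
    using assms by (simp flip: pure_add_left add: M.l_neg)
qed (use assms in auto)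

text \<open>Reduces claims about additive maps to pure tensors. Every coset is represented by a
  formal sum with integer coefficients, and such sums are built from generators by differences. Zero
  and the negative of a pure tensor are themselves pure, so sums suffice.\<close>

lemma tensor_induct [consumes 1, case_names pure add]:
  assumes "X \<in> carrier MN"
    and pure: "\<And>x y. x \<in> carrier M \<Longrightarrow> y \<in> carrier N \<Longrightarrow> P (pure x y)"
    and add: "\<And>X Y. X \<in> carrier MN \<Longrightarrow> Y \<in> carrier MN \<Longrightarrow> P X \<Longrightarrow> P Y \<Longrightarrow> P (X \<oplus>\<^bsub>MN\<^esub> Y)"
  shows "P X"
proof -
  have cos_diff: "cos (c - d) = cos c \<ominus>\<^bsub>MN\<^esub> cos d"
    if c: "Poly_Mapping.keys c \<subseteq> carrier M \<times> carrier N"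
      and d: "Poly_Mapping.keys d \<subseteq> carrier M \<times> carrier N" for c d
  proof -
    have "cos (c - d) \<oplus>\<^bsub>MN\<^esub> cos d = cos c"
      using keys_diff[of c d] c d by (subst add_cos) auto
    moreover have "cos (c - d) \<in> carrier MN" "cos d \<in> carrier MN" "cos c \<in> carrier MN"
      using keys_diff[of c d] c d by (auto simp: carrier_tensor)
    ultimately show ?thesis
      by (metis T.add.inv_solve_right T.minus_eq)
  qed
  have cos_zero: "cos 0 = \<zero>\<^bsub>MN\<^esub>"
    using cos_diff[of 0 0] by (simp add: T.minus_eq T.r_neg carrier_tensor)
  obtain c where c: "Poly_Mapping.keys c \<subseteq> carrier M \<times> carrier N" and X: "X = cos c"
    using assms(1) by (auto simp: carrier_tensor)
  \<comment> \<open>The negative of a pure tensor is pure, so carrying \<open>\<ominus> X\<close> along avoids a case for negatives.\<close>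
  have "cos c \<in> carrier MN \<and> P (cos c) \<and> P (\<ominus>\<^bsub>MN\<^esub> cos c)"
    using c
  proof (induction c rule: free_Abelian_group_induct[consumes 1, case_names zero diff of])
    case zero
    have "P \<zero>\<^bsub>MN\<^esub>" using pure[of "\<zero>\<^bsub>M\<^esub>" "\<zero>\<^bsub>N\<^esub>"] by simp
    moreover have "\<ominus>\<^bsub>MN\<^esub> \<zero>\<^bsub>MN\<^esub> = \<zero>\<^bsub>MN\<^esub>" by (rule T.minus_equality) auto
    ultimately show ?case by (simp only: cos_zero T.zero_closed simp_thms)
  next
    case (diff c d)
    then show ?case
      by (auto simp: cos_diff T.minus_eq T.minus_add intro!: add)
  next
    case (of a)
    then obtain x y where a: "a = (x, y)" "x \<in> carrier M" "y \<in> carrier N" by auto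
    show ?case
      using pure[of x y] pure[of "\<ominus>\<^bsub>M\<^esub> x" y] pure_minus_left[of x y] a pure_closed[of x y]
      by (simp add: pure_tensor_def)
  qed
  then show ?thesis by (simp add: X)
qed

text \<open>This is what makes the choice of representatives in \<^const>\<open>tensor_lift\<close> and in the scalar
  multiplication of \<^const>\<open>tensor_product\<close> irrelevant.\<close>

lemma hom_cos_const:
  assumes P: "abelian_group P" and g: "g \<in> hom free (add_monoid P)"
    and rel: "\<And>c. c \<in> tensor_relators R M N \<Longrightarrow> g c = \<zero>\<^bsub>P\<^esub>"
    and c: "Poly_Mapping.keys c \<subseteq> carrier M \<times> carrier N" and d: "d \<in> cos c"
  shows "g d = g c"
proof -
  interpret P: abelian_group P by (rule P)
  interpret g: group_hom free "add_monoid P" g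
    using g by unfold_locales
  \<comment> \<open>The kernel is a subgroup containing all relators, hence it contains the subgroup
    they generate.\<close>
  have "null \<subseteq> kernel free (add_monoid P) g"
    unfolding tensor_null_def
    by (rule group.generate_subgroup_incl[OF group_free_Abelian_group _ g.subgroup_kernel])
       (use rel subsetD[OF relators_closed] in \<open>auto simp: kernel_def simp del: carrier_free_Abelian_group_iff\<close>)
  then have null: "k \<in> carrier free" "g k = \<zero>\<^bsub>P\<^esub>" if "k \<in> null" for k
    using that by (auto simp: kernel_def)
  from d obtain k where k: "k \<in> null" "d = k + c" by (auto simp: r_coset_def)
  have "g d = g k \<oplus>\<^bsub>P\<^esub> g c"
    using g.hom_mult[of k c] null[OF k(1)] c by (simp add: k)
  then show ?thesis
    using null[OF k(1)] g.hom_closed[of c] c by simp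
qed

lemma mem_cos: "Poly_Mapping.keys c \<subseteq> carrier M \<times> carrier N \<Longrightarrow> c \<in> cos c"
  by (rule group.rcos_self[OF group_free_Abelian_group _ null_subgroup]) simp

section \<open>Balanced maps\<close>

text \<open>The target is only required to be an abelian group, so balancedness takes the place of
  bilinearity. Apart from closure, the conditions correspond one to one to the three families in
  \<open>tensor_relators\<close>.\<close>

definition balanced where
  "balanced P \<phi> \<longleftrightarrow>
    (\<forall>x\<in>carrier M. \<forall>y\<in>carrier N. \<phi> x y \<in> carrier P) \<and>
    (\<forall>x\<in>carrier M. \<forall>x'\<in>carrier M. \<forall>y\<in>carrier N. \<phi> (x \<oplus>\<^bsub>M\<^esub> x') y = \<phi> x y \<oplus>\<^bsub>P\<^esub> \<phi> x' y) \<and>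
    (\<forall>x\<in>carrier M. \<forall>y\<in>carrier N. \<forall>y'\<in>carrier N. \<phi> x (y \<oplus>\<^bsub>N\<^esub> y') = \<phi> x y \<oplus>\<^bsub>P\<^esub> \<phi> x y') \<and>
    (\<forall>r\<in>carrier R. \<forall>x\<in>carrier M. \<forall>y\<in>carrier N. \<phi> (r \<odot>\<^bsub>M\<^esub> x) y = \<phi> x (r \<odot>\<^bsub>N\<^esub> y))"

text \<open>Each equation in \<open>balanced\<close> kills one family of relators. Together with
  \<open>hom_cos_const\<close> this yields well-definedness twice: for scalar multiplication and for
  \<open>tensor_lift\<close>.\<close>

lemma relators_vanish:
  assumes P: "abelian_group P" and g: "g \<in> hom free (add_monoid P)"
    and \<phi>: "balanced P \<phi>"
    and g_of: "\<And>x y. x \<in> carrier M \<Longrightarrow> y \<in> carrier N \<Longrightarrow> g (frag_of (x, y)) = \<phi> x y"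
    and c: "c \<in> tensor_relators R M N"
  shows "g c = \<zero>\<^bsub>P\<^esub>"
proof -
  interpret P: abelian_group P by (rule P)
  interpret g: group_hom free "add_monoid P" g
    using g by unfold_locales
  \<comment> \<open>The support condition is proved alongside because relators are nested
    differences: rewriting the outer difference requires it for the inner one.\<close>
  have g_diff: "g (c - d) = g c \<ominus>\<^bsub>P\<^esub> g d" "Poly_Mapping.keys (c - d) \<subseteq> carrier M \<times> carrier N"
    if "Poly_Mapping.keys c \<subseteq> carrier M \<times> carrier N"
      and "Poly_Mapping.keys d \<subseteq> carrier M \<times> carrier N" for c d
  proof -
    show keys: "Poly_Mapping.keys (c - d) \<subseteq> carrier M \<times> carrier N"
      using keys_diff[of c d] that by auto
    have "g (c - d) \<oplus>\<^bsub>P\<^esub> g d = g c"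
      using g.hom_mult[of "c - d" d] keys that by simp
    then show "g (c - d) = g c \<ominus>\<^bsub>P\<^esub> g d"
      using keys that g.hom_closed[of "c - d"] g.hom_closed[of c] g.hom_closed[of d]
      by (metis P.add.inv_solve_right P.minus_eq carrier_free_Abelian_group_iff partial_object.select_convs(1))
  qed
  have \<phi>': "x \<in> carrier M \<Longrightarrow> y \<in> carrier N \<Longrightarrow> \<phi> x y \<in> carrier P" for x y
    using \<phi> by (simp add: balanced_def)
  have cancel: "(a \<oplus>\<^bsub>P\<^esub> b) \<ominus>\<^bsub>P\<^esub> a \<ominus>\<^bsub>P\<^esub> b = \<zero>\<^bsub>P\<^esub>"
    if "a \<in> carrier P" "b \<in> carrier P" for a b
  proof -
    have "(a \<oplus>\<^bsub>P\<^esub> b) \<ominus>\<^bsub>P\<^esub> a \<ominus>\<^bsub>P\<^esub> b = (a \<oplus>\<^bsub>P\<^esub> b) \<oplus>\<^bsub>P\<^esub> (\<ominus>\<^bsub>P\<^esub> a \<oplus>\<^bsub>P\<^esub> \<ominus>\<^bsub>P\<^esub> b)"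
      using that by (simp add: P.minus_eq P.a_assoc)
    also have "\<dots> = \<zero>\<^bsub>P\<^esub>"
      using that by (simp add: P.r_neg flip: P.minus_add)
    finally show ?thesis .
  qed
  show ?thesis
    using c unfolding tensor_relators_def
    using \<phi>
    by (auto simp: g_diff g_of balanced_def cancel P.r_neg[folded P.minus_eq])
qed


lemma balancedI:
  assumes "\<And>x y. x \<in> carrier M \<Longrightarrow> y \<in> carrier N \<Longrightarrow> \<phi> x y \<in> carrier P"
    and "\<And>x x' y. x \<in> carrier M \<Longrightarrow> x' \<in> carrier M \<Longrightarrow> y \<in> carrier N \<Longrightarrow>
      \<phi> (x \<oplus>\<^bsub>M\<^esub> x') y = \<phi> x y \<oplus>\<^bsub>P\<^esub> \<phi> x' y"
    and "\<And>x y y'. x \<in> carrier M \<Longrightarrow> y \<in> carrier N \<Longrightarrow> y' \<in> carrier N \<Longrightarrow>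
      \<phi> x (y \<oplus>\<^bsub>N\<^esub> y') = \<phi> x y \<oplus>\<^bsub>P\<^esub> \<phi> x y'"
    and "\<And>r x y. r \<in> carrier R \<Longrightarrow> x \<in> carrier M \<Longrightarrow> y \<in> carrier N \<Longrightarrow>
      \<phi> (r \<odot>\<^bsub>M\<^esub> x) y = \<phi> x (r \<odot>\<^bsub>N\<^esub> y)"
  shows "balanced P \<phi>"
  using assms by (simp add: balanced_def)

section \<open>Scalar multiplication\<close>

text \<open>Scaling the left entries sends relators into \<open>null\<close>, so all cosets in the
  union that defines the scalar action coincide and a single representative computes it.\<close>

lemma smult_cos:
  assumes r: "r \<in> carrier R" and c: "Poly_Mapping.keys c \<subseteq> carrier M \<times> carrier N"
  shows "r \<odot>\<^bsub>MN\<^esub> cos c = cos (frag_extend (\<lambda>(x, y). frag_of (r \<odot>\<^bsub>M\<^esub> x, y)) c)"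
    and "Poly_Mapping.keys (frag_extend (\<lambda>(x, y). frag_of (r \<odot>\<^bsub>M\<^esub> x, y)) c) \<subseteq> carrier M \<times> carrier N"
proof -
  define h where "h = frag_extend (\<lambda>(x, y :: 'e). frag_of (r \<odot>\<^bsub>M\<^esub> x, y))"
  have keys: "Poly_Mapping.keys (h c) \<subseteq> carrier M \<times> carrier N"
    if "Poly_Mapping.keys c \<subseteq> carrier M \<times> carrier N" for c
  proof -
    show ?thesis
      unfolding h_def
      by (rule order_trans[OF keys_frag_extend]) (use that r in auto)
  qed
  have h_add: "h (c + d) = h c + h d" for c d
    by (simp add: h_def frag_extend_add)
  have hom: "(\<lambda>c. cos (h c)) \<in> hom free (add_monoid MN)"
    by (rule homI) (auto simp: carrier_tensor keys add_cos h_add)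
  have balanced: "balanced MN (\<lambda>x y. pure (r \<odot>\<^bsub>M\<^esub> x) y)"
  proof (rule balancedI)
    fix a x y assume axy: "a \<in> carrier R" "x \<in> carrier M" "y \<in> carrier N"
    \<comment> \<open>Commutativity of \<open>R\<close> enters here: scaling by \<open>r\<close>
      must commute with the scalar \<open>a\<close> that is moved across the tensor sign.\<close>
    have "r \<odot>\<^bsub>M\<^esub> (a \<odot>\<^bsub>M\<^esub> x) = (r \<otimes> a) \<odot>\<^bsub>M\<^esub> x"
      using axy r by (simp add: M.smult_assoc1)
    also have "\<dots> = a \<odot>\<^bsub>M\<^esub> (r \<odot>\<^bsub>M\<^esub> x)"
      using axy r M.smult_assoc1[of a r x] by (simp only: M.R.m_comm)
    finally show "pure (r \<odot>\<^bsub>M\<^esub> (a \<odot>\<^bsub>M\<^esub> x)) y = pure (r \<odot>\<^bsub>M\<^esub> x) (a \<odot>\<^bsub>N\<^esub> y)"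
      using axy r pure_smult_left[of a "r \<odot>\<^bsub>M\<^esub> x" y] by simp
  qed (use r in \<open>simp_all add: pure_add_left pure_add_right M.smult_r_distr\<close>)
  have const: "cos (h d) = cos (h c)" if "d \<in> cos c" for d
    by (rule hom_cos_const[OF abelian_group_tensor hom relators_vanish[OF abelian_group_tensor hom balanced] c that])
       (auto simp: h_def pure_tensor_def)
  have "r \<odot>\<^bsub>MN\<^esub> cos c = (\<Union>d\<in>cos c. cos (h d))"
    by (simp add: tensor_product_def Let_def h_def)
  also have "\<dots> = cos (h c)"
    by (rule SUP_eq_const) (use mem_cos[OF c] in blast, rule const)
  finally show "r \<odot>\<^bsub>MN\<^esub> cos c = cos (frag_extend (\<lambda>(x, y). frag_of (r \<odot>\<^bsub>M\<^esub> x, y)) c)"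
    by (simp add: h_def)
  show "Poly_Mapping.keys (frag_extend (\<lambda>(x, y). frag_of (r \<odot>\<^bsub>M\<^esub> x, y)) c) \<subseteq> carrier M \<times> carrier N"
    using keys[OF c] by (simp add: h_def)
qed

lemma smult_pure:
  assumes "r \<in> carrier R" "x \<in> carrier M" "y \<in> carrier N"
  shows "r \<odot>\<^bsub>MN\<^esub> pure x y = pure (r \<odot>\<^bsub>M\<^esub> x) y"
  unfolding pure_tensor_def using assms by (simp add: smult_cos)

lemma smult_tensor_closed:
  "r \<in> carrier R \<Longrightarrow> X \<in> carrier MN \<Longrightarrow> r \<odot>\<^bsub>MN\<^esub> X \<in> carrier MN"
  by (auto simp: carrier_tensor smult_cos)

lemma smult_tensor_add:
  assumes "r \<in> carrier R" "X \<in> carrier MN" "Y \<in> carrier MN"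
  shows "r \<odot>\<^bsub>MN\<^esub> (X \<oplus>\<^bsub>MN\<^esub> Y) = r \<odot>\<^bsub>MN\<^esub> X \<oplus>\<^bsub>MN\<^esub> r \<odot>\<^bsub>MN\<^esub> Y"
  using assms by (auto simp: carrier_tensor smult_cos add_cos keys_add_subset frag_extend_add)

text \<open>Allows a tensor product to serve as a factor of another one, as the triple products in
  the coassociativity law require.\<close>

lemma module_tensor: "Module.module R MN"
proof (rule moduleI)
  show "cring R" by (rule M.R.is_cring)
  show "abelian_group MN" by (rule abelian_group_tensor)
next
  fix a b X assume a: "a \<in> carrier R" and b: "b \<in> carrier R" and X: "X \<in> carrier MN"
  show "(a \<oplus> b) \<odot>\<^bsub>MN\<^esub> X = a \<odot>\<^bsub>MN\<^esub> X \<oplus>\<^bsub>MN\<^esub> b \<odot>\<^bsub>MN\<^esub> X"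
    using X
  proof (induction X rule: tensor_induct)
    case (add X Y)
    have "(a \<oplus> b) \<odot>\<^bsub>MN\<^esub> (X \<oplus>\<^bsub>MN\<^esub> Y)
        = (a \<odot>\<^bsub>MN\<^esub> X \<oplus>\<^bsub>MN\<^esub> b \<odot>\<^bsub>MN\<^esub> X) \<oplus>\<^bsub>MN\<^esub> (a \<odot>\<^bsub>MN\<^esub> Y \<oplus>\<^bsub>MN\<^esub> b \<odot>\<^bsub>MN\<^esub> Y)"
      using add a b by (simp add: smult_tensor_add)
    also have "\<dots> = (a \<odot>\<^bsub>MN\<^esub> X \<oplus>\<^bsub>MN\<^esub> a \<odot>\<^bsub>MN\<^esub> Y) \<oplus>\<^bsub>MN\<^esub> (b \<odot>\<^bsub>MN\<^esub> X \<oplus>\<^bsub>MN\<^esub> b \<odot>\<^bsub>MN\<^esub> Y)"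
      by (rule T.add_swap) (use add a b in \<open>auto intro: smult_tensor_closed\<close>)
    finally show ?case
      using add a b by (simp add: smult_tensor_add)
  qed (use a b in \<open>simp add: smult_pure M.smult_l_distr pure_add_left\<close>)
  show "(a \<otimes> b) \<odot>\<^bsub>MN\<^esub> X = a \<odot>\<^bsub>MN\<^esub> (b \<odot>\<^bsub>MN\<^esub> X)"
    using X
    by (induction X rule: tensor_induct)
       (use a b in \<open>simp_all add: smult_pure M.smult_assoc1 smult_tensor_add smult_tensor_closed\<close>)
next
  fix X assume X: "X \<in> carrier MN"
  show "\<one> \<odot>\<^bsub>MN\<^esub> X = X"
    using X by (induction X rule: tensor_induct) (simp_all add: smult_pure smult_tensor_add)
qed (simp_all add: smult_tensor_add smult_tensor_closed)

end

section \<open>Maps out of a tensor product\<close>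

text \<open>The universal property of the free abelian group, for the explicit sum used in
  \<open>tensor_lift\<close>. The supports of \<open>c\<close>, \<open>d\<close> and
  \<open>c + d\<close> may differ, so all three sums are extended to the union of the first two
  supports; the added terms have coefficient 0.\<close>

lemma (in abelian_group) frag_sum_hom:
  assumes \<phi>: "\<And>z. z \<in> S \<Longrightarrow> \<phi> z \<in> carrier G"
  shows "(\<lambda>c. \<Oplus>z\<in>Poly_Mapping.keys c. [Poly_Mapping.lookup c z] \<cdot> \<phi> z)
    \<in> hom (free_Abelian_group S) (add_monoid G)"
proof -
  have pow_0: "[(0 :: int)] \<cdot> x = \<zero>" for x
    by (simp add: add_pow_def)
  have pow_closed: "[(k :: int)] \<cdot> \<phi> z \<in> carrier G" if "z \<in> S" for k z
    using add.int_pow_closed[OF \<phi>[OF that]] .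
  define \<Phi> where "\<Phi> c = (\<Oplus>z\<in>Poly_Mapping.keys c. [Poly_Mapping.lookup c z] \<cdot> \<phi> z)"
    for c :: "'c \<Rightarrow>\<^sub>0 int"
  have on: "\<Phi> c = (\<Oplus>z\<in>B. [Poly_Mapping.lookup c z] \<cdot> \<phi> z)"
    if "finite B" "Poly_Mapping.keys c \<subseteq> B" "B \<subseteq> S" for B c
    unfolding \<Phi>_def
    by (rule add.finprod_mono_neutral_cong_left)
       (use that in \<open>auto simp: in_keys_iff pow_0 intro!: pow_closed\<close>)
  have "\<Phi> \<in> hom (free_Abelian_group S) (add_monoid G)"
  proof (rule homI)
    fix c assume "c \<in> carrier (free_Abelian_group S)"
    then show "\<Phi> c \<in> carrier (add_monoid G)"
      unfolding \<Phi>_def by (auto intro!: finsum_closed pow_closed)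
  next
    fix c d assume "c \<in> carrier (free_Abelian_group S)" "d \<in> carrier (free_Abelian_group S)"
    then have cd: "Poly_Mapping.keys c \<subseteq> S" "Poly_Mapping.keys d \<subseteq> S" by auto
    let ?B = "Poly_Mapping.keys c \<union> Poly_Mapping.keys d"
    have "\<Phi> (c + d) = (\<Oplus>z\<in>?B. [Poly_Mapping.lookup (c + d) z] \<cdot> \<phi> z)"
      by (rule on) (use cd in \<open>auto dest: subsetD[OF Poly_Mapping.keys_add]\<close>)
    also have "\<dots> = (\<Oplus>z\<in>?B. [Poly_Mapping.lookup c z] \<cdot> \<phi> z \<oplus> [Poly_Mapping.lookup d z] \<cdot> \<phi> z)"
      by (rule finsum_cong'[OF refl]) (use cd \<phi> in \<open>auto simp: lookup_add add.int_pow_mult subset_iff\<close>)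
    also have "\<dots> = \<Phi> c \<oplus> \<Phi> d"
      using cd \<phi> by (subst finsum_addf) (auto simp: on[of ?B])
    finally show "\<Phi> (c \<otimes>\<^bsub>free_Abelian_group S\<^esub> d) = \<Phi> c \<otimes>\<^bsub>add_monoid G\<^esub> \<Phi> d"
      by simp
  qed
  then show ?thesis by (simp add: \<Phi>_def[abs_def])
qed

context tensor_modules
begin

text \<open>The explicit sum is a homomorphism that vanishes on relators, hence constant on a coset.
  Its image is therefore a singleton, from which \<open>the_elem\<close> reads off the
  value.\<close>

lemma tensor_lift_cos:
  assumes P: "abelian_group P" and \<phi>: "balanced P \<phi>"
    and c: "Poly_Mapping.keys c \<subseteq> carrier M \<times> carrier N"
  shows "tensor_lift P \<phi> (cos c) =
    (\<Oplus>\<^bsub>P\<^esub>z\<in>Poly_Mapping.keys c. [Poly_Mapping.lookup c z] \<cdot>\<^bsub>P\<^esub> \<phi> (fst z) (snd z))"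
proof -
  interpret P: abelian_group P by (rule P)
  let ?g = "\<lambda>c. \<Oplus>\<^bsub>P\<^esub>z\<in>Poly_Mapping.keys c. [Poly_Mapping.lookup c z] \<cdot>\<^bsub>P\<^esub> \<phi> (fst z) (snd z)"
  have \<phi>': "\<phi> x y \<in> carrier P" if "x \<in> carrier M" "y \<in> carrier N" for x y
    using \<phi> that by (simp add: balanced_def)
  have hom: "?g \<in> hom free (add_monoid P)"
    by (rule P.frag_sum_hom) (use \<phi>' in auto)
  have "?g d = ?g c" if "d \<in> cos c" for d
    by (rule hom_cos_const[OF P hom relators_vanish[OF P hom \<phi>] c that])
       (use \<phi>' in auto)
  then have "?g ` cos c = (\<lambda>_. ?g c) ` cos c"
    by (rule image_cong[OF refl])
  also have "\<dots> = {?g c}"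
    by (rule image_constant[OF mem_cos[OF c]])
  finally have "?g ` cos c = {?g c}" .
  then show ?thesis by (simp add: tensor_lift_def)
qed

lemma tensor_lift_pure:
  assumes "abelian_group P" "balanced P \<phi>" "x \<in> carrier M" "y \<in> carrier N"
  shows "tensor_lift P \<phi> (pure x y) = \<phi> x y"
proof -
  interpret P: abelian_group P by fact
  have "\<phi> x y \<in> carrier P" using assms by (simp add: balanced_def)
  then show ?thesis using assms by (simp add: pure_tensor_def tensor_lift_cos)
qed

lemma tensor_lift_add:
  assumes P: "abelian_group P" and \<phi>: "balanced P \<phi>" and XY: "X \<in> carrier MN" "Y \<in> carrier MN"
  shows "tensor_lift P \<phi> (X \<oplus>\<^bsub>MN\<^esub> Y) = tensor_lift P \<phi> X \<oplus>\<^bsub>P\<^esub> tensor_lift P \<phi> Y"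
proof -
  interpret P: abelian_group P by (rule P)
  have "\<And>z. z \<in> carrier M \<times> carrier N \<Longrightarrow> \<phi> (fst z) (snd z) \<in> carrier P"
    using \<phi> by (auto simp: balanced_def)
  from hom_mult[OF P.frag_sum_hom[OF this]] XY show ?thesis
    by (auto simp: carrier_tensor add_cos tensor_lift_cos[OF P \<phi>] keys_add_subset)
qed

lemma tensor_lift_closed:
  assumes P: "abelian_group P" and \<phi>: "balanced P \<phi>" and X: "X \<in> carrier MN"
  shows "tensor_lift P \<phi> X \<in> carrier P"
proof -
  interpret P: abelian_group P by (rule P)
  show ?thesis
    using X
    by (induction X rule: tensor_induct)
       (use \<phi> in \<open>auto simp: tensor_lift_pure[OF P \<phi>] tensor_lift_add[OF P \<phi>] balanced_def\<close>)
qed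


section \<open>Functoriality\<close>

text \<open>Since \<open>f\<close> and \<open>g\<close> commute with sums and scalars, the relations
  between pure tensors of the target pull back to the source.\<close>

lemma balanced_map:
  assumes T': "tensor_modules R M' N'"
    and f: "f \<in> LinearCombinations.module_hom R M M'"
    and g: "g \<in> LinearCombinations.module_hom R N N'"
  shows "balanced (tensor_product R M' N') (\<lambda>x y. pure_tensor R M' N' (f x) (g y))"
proof -
  interpret T': tensor_modules R M' N' by (rule T')
  show ?thesis
    using f g unfolding LinearCombinations.module_hom_def
    by (intro balancedI)
       (auto simp: T'.pure_add_left T'.pure_add_right T'.pure_smult_left Pi_iff)
qed

lemma tensor_map_pure:
  assumes "tensor_modules R M' N'" "f \<in> LinearCombinations.module_hom R M M'"
    "g \<in> LinearCombinations.module_hom R N N'" "x \<in> carrier M" "y \<in> carrier N"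
  shows "tensor_map R M' N' f g (pure x y) = pure_tensor R M' N' (f x) (g y)"
  unfolding tensor_map_def
  by (rule tensor_lift_pure[OF tensor_modules.abelian_group_tensor balanced_map]) fact+

lemma tensor_map_add:
  assumes "tensor_modules R M' N'" "f \<in> LinearCombinations.module_hom R M M'"
    "g \<in> LinearCombinations.module_hom R N N'" "X \<in> carrier MN" "Y \<in> carrier MN"
  shows "tensor_map R M' N' f g (X \<oplus>\<^bsub>MN\<^esub> Y) =
    tensor_map R M' N' f g X \<oplus>\<^bsub>tensor_product R M' N'\<^esub> tensor_map R M' N' f g Y"
  unfolding tensor_map_def
  by (rule tensor_lift_add[OF tensor_modules.abelian_group_tensor balanced_map]) fact+

end

text \<open>The map is a lift of a lift, so balancedness is needed at two levels: first in
  \<open>x\<close> and \<open>y\<close> for fixed \<open>z\<close>, then for the lifted map in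
  \<open>X\<close> and \<open>z\<close>. At the second level additivity in \<open>X\<close> comes
  from the lift, while the laws for \<open>z\<close> and for scalars follow by induction on
  \<open>X\<close>.\<close>

lemma tensor_assoc_pure:
  assumes M: "Module.module R M" and N: "Module.module R N" and P: "Module.module R P"
    and "x \<in> carrier M" "y \<in> carrier N" "z \<in> carrier P"
  shows "tensor_assoc R M N P (pure_tensor R (tensor_product R M N) P (pure_tensor R M N x y) z) =
    pure_tensor R M (tensor_product R N P) x (pure_tensor R N P y z)"
proof -
  interpret MN: tensor_modules R M N by (rule tensor_modules.intro[OF M N])
  interpret NP: tensor_modules R N P by (rule tensor_modules.intro[OF N P])
  interpret MN_P: tensor_modules R "tensor_product R M N" P
    by (rule tensor_modules.intro[OF MN.module_tensor P])
  interpret M_NP: tensor_modules R M "tensor_product R N P"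
    by (rule tensor_modules.intro[OF M NP.module_tensor])
  define \<phi> where "\<phi> z x y = M_NP.pure x (NP.pure y z)" for z x y
  have \<phi>_closed: "\<phi> z x y \<in> carrier M_NP.MN"
    if "x \<in> carrier M" "y \<in> carrier N" "z \<in> carrier P" for x y z
    using that by (simp add: \<phi>_def)
  have \<phi>_balanced: "MN.balanced M_NP.MN (\<phi> z)" if "z \<in> carrier P" for z
    using that
    by (intro MN.balancedI)
       (simp_all add: \<phi>_def M_NP.pure_add_left M_NP.pure_add_right NP.pure_add_left
          M_NP.pure_smult_left NP.smult_pure)
  have \<phi>_add: "\<phi> (z \<oplus>\<^bsub>P\<^esub> z') x y = \<phi> z x y \<oplus>\<^bsub>M_NP.MN\<^esub> \<phi> z' x y"
    if "x \<in> carrier M" "y \<in> carrier N" "z \<in> carrier P" "z' \<in> carrier P" for x y z z'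
    using that by (simp add: \<phi>_def M_NP.pure_add_right NP.pure_add_right)
  \<comment> \<open>The scalar travels from \<open>z\<close> to \<open>y\<close>, out of the inner
    tensor, and across the outer tensor sign to \<open>x\<close>.\<close>
  have \<phi>_smult: "\<phi> (r \<odot>\<^bsub>P\<^esub> z) x y = \<phi> z (r \<odot>\<^bsub>M\<^esub> x) y"
    if "r \<in> carrier R" "x \<in> carrier M" "y \<in> carrier N" "z \<in> carrier P" for r x y z
    using that by (simp add: \<phi>_def M_NP.pure_smult_left NP.smult_pure NP.pure_smult_left)
  define \<psi> where "\<psi> X z = tensor_lift M_NP.MN (\<phi> z) X" for X z
  note lift_pure = MN.tensor_lift_pure[OF M_NP.abelian_group_tensor \<phi>_balanced]
  note lift_add = MN.tensor_lift_add[OF M_NP.abelian_group_tensor \<phi>_balanced]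
  note lift_closed = MN.tensor_lift_closed[OF M_NP.abelian_group_tensor \<phi>_balanced]
  have "MN_P.balanced M_NP.MN \<psi>"
  proof (rule MN_P.balancedI)
    fix X z z' assume X: "X \<in> carrier MN.MN" and z: "z \<in> carrier P" "z' \<in> carrier P"
    show "\<psi> X (z \<oplus>\<^bsub>P\<^esub> z') = \<psi> X z \<oplus>\<^bsub>M_NP.MN\<^esub> \<psi> X z'"
      using X
    proof (induction X rule: MN.tensor_induct)
      case (pure x y)
      then show ?case using z by (simp add: \<psi>_def lift_pure \<phi>_add)
    next
      case (add X Y)
      then show ?case
        using z M_NP.T.add_swap[of "\<psi> X z" "\<psi> X z'" "\<psi> Y z" "\<psi> Y z'"]
        by (simp add: \<psi>_def lift_add lift_closed)
    qed
  next
    fix r X z assume r: "r \<in> carrier R" and X: "X \<in> carrier MN.MN" and z: "z \<in> carrier P"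
    show "\<psi> (r \<odot>\<^bsub>MN.MN\<^esub> X) z = \<psi> X (r \<odot>\<^bsub>P\<^esub> z)"
      using X
    proof (induction X rule: MN.tensor_induct)
      case (pure x y)
      then show ?case using r z by (simp add: \<psi>_def MN.smult_pure lift_pure \<phi>_smult)
    next
      case (add X Y)
      then show ?case
        using r z by (simp add: \<psi>_def MN.smult_tensor_add MN.smult_tensor_closed lift_add)
    qed
  qed (simp_all add: \<psi>_def lift_add lift_closed)
  then have "tensor_lift M_NP.MN \<psi> (MN_P.pure (MN.pure x y) z) = \<psi> (MN.pure x y) z"
    by (rule MN_P.tensor_lift_pure[OF M_NP.abelian_group_tensor]) (use assms in auto)
  also have "\<dots> = M_NP.pure x (NP.pure y z)"
    \<comment> \<open>\<open>\<phi>\<close> stays folded until \<open>lift_pure\<close>, whose left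
      side mentions it, has been applied.\<close>
    using assms by (simp add: \<psi>_def lift_pure) (simp add: \<phi>_def)
  finally show ?thesis
    by (simp add: tensor_assoc_def Let_def \<psi>_def[abs_def] \<phi>_def[abs_def])
qed

section \<open>The coproduct of a square-zero element\<close>

context unital_assoc_algebra
begin

text \<open>Lets the left action on \<open>A \<otimes> A\<close> be computed by
  \<open>tensor_map_pure\<close> and \<open>tensor_map_add\<close>.\<close>

lemma mult_left_hom:
  "a \<in> carrier A \<Longrightarrow> (\<lambda>b. a \<otimes>\<^bsub>A\<^esub> b) \<in> LinearCombinations.module_hom R A A"
  by (auto simp: LinearCombinations.module_hom_def r_distr smult_mult_right)

lemma mult_right_hom:
  "a \<in> carrier A \<Longrightarrow> (\<lambda>b. b \<otimes>\<^bsub>A\<^esub> a) \<in> LinearCombinations.module_hom R A A"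
  by (auto simp: LinearCombinations.module_hom_def l_distr smult_mult_left)


theorem square_zero_bialgebra:
  assumes L: "L \<in> carrier A" and LL: "L \<otimes>\<^bsub>A\<^esub> L = \<zero>\<^bsub>A\<^esub>"
  shows "infinitesimal_unitary_bialgebra R A \<zero>
    (\<lambda>a. pure_tensor R A A (a \<otimes>\<^bsub>A\<^esub> L) L \<ominus>\<^bsub>tensor_product R A A\<^esub> pure_tensor R A A L (L \<otimes>\<^bsub>A\<^esub> a))"
    (is "infinitesimal_unitary_bialgebra R A \<zero> ?\<Delta>")
proof -
  have A: "Module.module R A" by unfold_locales
  interpret AA: tensor_modules R A A by (rule tensor_modules.intro[OF A A])
  interpret AA_A: tensor_modules R AA.MN A by (rule tensor_modules.intro[OF AA.module_tensor A])
  interpret A_AA: tensor_modules R A AA.MN by (rule tensor_modules.intro[OF A AA.module_tensor])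
  define \<Delta> where "\<Delta> = ?\<Delta>"
  have minus_L: "\<ominus>\<^bsub>A\<^esub> L \<in> carrier A" using L by simp
  \<comment> \<open>The sign is absorbed into the left factor, so \<open>\<Delta> a\<close> becomes
    a sum of two pure tensors and the rules for sums and pure tensors suffice.\<close>
  have \<Delta>: "\<Delta> a = AA.pure (a \<otimes>\<^bsub>A\<^esub> L) L \<oplus>\<^bsub>AA.MN\<^esub> AA.pure (\<ominus>\<^bsub>A\<^esub> L) (L \<otimes>\<^bsub>A\<^esub> a)"
    if "a \<in> carrier A" for a
    using that L by (simp add: \<Delta>_def a_minus_def AA.pure_minus_left)
  have id_hom: "(\<lambda>x. x) \<in> LinearCombinations.module_hom R A A"
    by (simp add: LinearCombinations.module_hom_def)
  have \<Delta>_hom: "\<Delta> \<in> LinearCombinations.module_hom R A AA.MN"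
  proof -
    have "\<Delta> (a \<oplus>\<^bsub>A\<^esub> b) = \<Delta> a \<oplus>\<^bsub>AA.MN\<^esub> \<Delta> b" if "a \<in> carrier A" "b \<in> carrier A" for a b
      using that L minus_L
      by (simp add: \<Delta> l_distr r_distr AA.pure_add_left AA.pure_add_right AA.T.add_swap)
    \<comment> \<open>In the second summand \<open>a\<close> stands in the right factor while
      scalars act on the left one, so \<open>r\<close> has to cross the tensor sign at
      \<open>\<ominus> L\<close>.\<close>
    moreover have "\<Delta> (r \<odot>\<^bsub>A\<^esub> a) = r \<odot>\<^bsub>AA.MN\<^esub> \<Delta> a" if "r \<in> carrier R" "a \<in> carrier A" for r a
      using that L minus_L
      by (simp add: \<Delta> smult_mult_left smult_mult_right AA.smult_tensor_add AA.smult_pure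
          AA.pure_smult_left[of r "\<ominus>\<^bsub>A\<^esub> L"])
    moreover have "\<Delta> a \<in> carrier AA.MN" if "a \<in> carrier A" for a
      using that L minus_L by (simp add: \<Delta>)
    ultimately show ?thesis by (simp add: LinearCombinations.module_hom_def)
  qed
  have zero_mult: "L \<otimes>\<^bsub>A\<^esub> (L \<otimes>\<^bsub>A\<^esub> a) = \<zero>\<^bsub>A\<^esub>" "(a \<otimes>\<^bsub>A\<^esub> L) \<otimes>\<^bsub>A\<^esub> L = \<zero>\<^bsub>A\<^esub>"
    if "a \<in> carrier A" for a
  proof -
    show "L \<otimes>\<^bsub>A\<^esub> (L \<otimes>\<^bsub>A\<^esub> a) = \<zero>\<^bsub>A\<^esub>"
      using that L by (simp add: LL flip: m_assoc)
    show "(a \<otimes>\<^bsub>A\<^esub> L) \<otimes>\<^bsub>A\<^esub> L = \<zero>\<^bsub>A\<^esub>"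
      using that L by (simp add: LL m_assoc)
  qed
  have coassoc: "tensor_assoc R A A A (tensor_map R AA.MN A \<Delta> (\<lambda>x. x) (\<Delta> a)) =
      tensor_map R A AA.MN (\<lambda>x. x) \<Delta> (\<Delta> a)" if a: "a \<in> carrier A" for a
  proof -
    let ?x = "L \<otimes>\<^bsub>A\<^esub> (a \<otimes>\<^bsub>A\<^esub> L)"
    \<comment> \<open>Both summands of \<open>\<Delta> L\<close> contain the square of
      \<open>L\<close>. In \<open>\<Delta> (a L)\<close> and \<open>\<Delta> (L a)\<close> exactly
      one summand contains it, and the other one survives.\<close>
    have \<Delta>_L: "\<Delta> L = \<zero>\<^bsub>AA.MN\<^esub>" "\<Delta> (\<ominus>\<^bsub>A\<^esub> L) = \<zero>\<^bsub>AA.MN\<^esub>"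
      using L minus_L LL by (simp_all add: \<Delta> l_minus r_minus)
    have \<Delta>_aL: "\<Delta> (a \<otimes>\<^bsub>A\<^esub> L) = AA.pure (\<ominus>\<^bsub>A\<^esub> L) ?x"
      using a L minus_L by (simp add: \<Delta> zero_mult)
    have \<Delta>_La: "\<Delta> (L \<otimes>\<^bsub>A\<^esub> a) = AA.pure ?x L"
      using a L minus_L by (simp add: \<Delta> zero_mult m_assoc)
    \<comment> \<open>The summand of \<open>\<Delta> a\<close> with \<open>\<ominus> L\<close> on
      the left is killed by \<open>\<Delta>_L\<close>; the other is evaluated by
      \<open>\<Delta>_aL\<close>. For the identity tensored with \<open>\<Delta>\<close> the roles
      of the two summands are exchanged.\<close>
    have "tensor_map R AA.MN A \<Delta> (\<lambda>x. x) (\<Delta> a) = AA_A.pure (AA.pure (\<ominus>\<^bsub>A\<^esub> L) ?x) L"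
      using a L minus_L
      by (simp add: \<Delta>[OF a] \<Delta>_L \<Delta>_aL AA.tensor_map_add[OF AA_A.tensor_modules_axioms \<Delta>_hom id_hom]
          AA.tensor_map_pure[OF AA_A.tensor_modules_axioms \<Delta>_hom id_hom])
    moreover have "tensor_map R A AA.MN (\<lambda>x. x) \<Delta> (\<Delta> a) = A_AA.pure (\<ominus>\<^bsub>A\<^esub> L) (AA.pure ?x L)"
      using a L minus_L
      by (simp add: \<Delta>[OF a] \<Delta>_L \<Delta>_La AA.tensor_map_add[OF A_AA.tensor_modules_axioms id_hom \<Delta>_hom]
          AA.tensor_map_pure[OF A_AA.tensor_modules_axioms id_hom \<Delta>_hom])
    ultimately show ?thesis
      using a L minus_L by (simp add: tensor_assoc_pure[OF A A A])
  qed
  have derivation: "\<Delta> (a \<otimes>\<^bsub>A\<^esub> b) = tensor_left_act R A a (\<Delta> b) \<oplus>\<^bsub>AA.MN\<^esub> tensor_right_act R A (\<Delta> a) b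
      \<oplus>\<^bsub>AA.MN\<^esub> \<zero> \<odot>\<^bsub>AA.MN\<^esub> AA.pure a b" if a: "a \<in> carrier A" and b: "b \<in> carrier A" for a b
  proof -
    \<comment> \<open>The mixed term: it occurs with a plus sign in the right action and with a
      minus sign in the left action.\<close>
    let ?X = "AA.pure (a \<otimes>\<^bsub>A\<^esub> L) (L \<otimes>\<^bsub>A\<^esub> b)"
    have left: "tensor_left_act R A a (\<Delta> b) = AA.pure (a \<otimes>\<^bsub>A\<^esub> b \<otimes>\<^bsub>A\<^esub> L) L
        \<oplus>\<^bsub>AA.MN\<^esub> AA.pure (\<ominus>\<^bsub>A\<^esub> (a \<otimes>\<^bsub>A\<^esub> L)) (L \<otimes>\<^bsub>A\<^esub> b)"
      using a b L minus_L mult_left_hom[OF a]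
      by (simp add: tensor_left_act_def \<Delta> AA.tensor_map_add[OF AA.tensor_modules_axioms _ id_hom]
          AA.tensor_map_pure[OF AA.tensor_modules_axioms _ id_hom] m_assoc r_minus)
    have right: "tensor_right_act R A (\<Delta> a) b = ?X \<oplus>\<^bsub>AA.MN\<^esub> AA.pure (\<ominus>\<^bsub>A\<^esub> L) (L \<otimes>\<^bsub>A\<^esub> (a \<otimes>\<^bsub>A\<^esub> b))"
      using a b L minus_L mult_right_hom[OF b]
      by (simp add: tensor_right_act_def \<Delta> AA.tensor_map_add[OF AA.tensor_modules_axioms id_hom]
          AA.tensor_map_pure[OF AA.tensor_modules_axioms id_hom] m_assoc)
    have ab: "a \<otimes>\<^bsub>A\<^esub> b \<in> carrier A" using a b by simp
    show ?thesis
      unfolding left right \<Delta>[OF ab]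
      using a b L minus_L
      by (simp add: AA.pure_minus_left Module.module.smult_l_null[OF AA.module_tensor] AA.T.a_assoc AA.T.r_neg1)
  qed
  show ?thesis
    unfolding \<Delta>_def[symmetric]
    by (intro infinitesimal_unitary_bialgebra.intro infinitesimal_unitary_bialgebra_axioms.intro
          unital_assoc_algebra_axioms \<Delta>_hom coassoc derivation) auto
qed

end

section \<open>Matrix algebras\<close>

lemma cring_class_ring: "cring (class_ring :: 'k :: {comm_ring, comm_monoid_mult} ring)"
proof -
  \<comment> \<open>Supplies the inverses required for every element to be a unit of the additive
    monoid.\<close>
  have "\<exists>y. x + y = 0" for x :: 'k
    by (rule exI[of _ "- x"]) simp
  then show ?thesis
    by unfold_locales (auto simp: Units_def algebra_simps)
qed

text \<open>The library's unit laws for matrices require \<^class>\<open>semiring_1\<close>, hence \<open>0 \<noteq> 1\<close>.\<close>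

lemma one_mat_mult:
  fixes B :: "'k :: {comm_ring, comm_monoid_mult} mat"
  assumes "B \<in> carrier_mat n m"
  shows "1\<^sub>m n * B = B"
proof (rule eq_matI)
  fix i j assume ij: "i < dim_row B" "j < dim_col B"
  have "(1\<^sub>m n * B) $$ (i, j) = (\<Sum>k = 0..<n. 1\<^sub>m n $$ (i, k) * B $$ (k, j))"
    using ij assms by (simp add: scalar_prod_def)
  also have "\<dots> = (\<Sum>k = 0..<n. if k = i then B $$ (k, j) else 0)"
    by (rule sum.cong) (use ij assms in auto)
  also have "\<dots> = B $$ (i, j)"
    using ij assms by simp
  finally show "(1\<^sub>m n * B) $$ (i, j) = B $$ (i, j)" .
qed (use assms in auto)

lemma mult_one_mat:
  fixes B :: "'k :: {comm_ring, comm_monoid_mult} mat"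
  assumes "B \<in> carrier_mat n m"
  shows "B * 1\<^sub>m m = B"
proof (rule eq_matI)
  fix i j assume ij: "i < dim_row B" "j < dim_col B"
  have "(B * 1\<^sub>m m) $$ (i, j) = (\<Sum>k = 0..<m. B $$ (i, k) * 1\<^sub>m m $$ (k, j))"
    using ij assms by (simp add: scalar_prod_def)
  also have "\<dots> = (\<Sum>k = 0..<m. if k = j then B $$ (i, k) else 0)"
    by (rule sum.cong) (use ij assms in auto)
  also have "\<dots> = B $$ (i, j)"
    using ij assms by simp
  finally show "(B * 1\<^sub>m m) $$ (i, j) = B $$ (i, j)" .
qed (use assms in auto)

lemma unital_assoc_algebra_mat:
  "unital_assoc_algebra (class_ring :: 'k :: {comm_ring, comm_monoid_mult} ring) (mat_algebra n)"
proof -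
  let ?A = "mat_algebra n :: ('k, 'k mat) module"
  have abelian: "abelian_group ?A"
  proof (rule abelian_groupI)
    fix B assume "B \<in> carrier ?A"
    then show "\<exists>C\<in>carrier ?A. C \<oplus>\<^bsub>?A\<^esub> B = \<zero>\<^bsub>?A\<^esub>"
      by (intro bexI[of _ "- B"]) (auto simp: mat_algebra_def)
  qed (auto simp: mat_algebra_def intro: comm_add_mat)
  have "Module.module (class_ring :: 'k ring) ?A"
    by (rule moduleI[OF cring_class_ring abelian])
       (auto simp: mat_algebra_def algebra_simps intro!: eq_matI)
  moreover have "ring ?A"
  proof (rule ringI[OF abelian])
    show "monoid ?A"
      by (rule monoidI) (auto simp: mat_algebra_def one_mat_mult mult_one_mat)
  qed (auto simp: mat_algebra_def add_mult_distrib_mat mult_add_distrib_mat)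
  moreover have "unital_assoc_algebra_axioms (class_ring :: 'k ring) ?A"
    by unfold_locales
       \<comment> \<open>The dimensions occur only in the premises of these two rules, so they are
         fixed to \<open>n\<close> explicitly.\<close>
       (auto simp: mat_algebra_def mult_smult_assoc_mat[of _ n n _ n] mult_smult_distrib[of _ n n _ n])
  ultimately show ?thesis by (rule unital_assoc_algebra.intro)
qed

theorem theorem2p8:
  fixes n :: nat and L :: "'k :: {comm_ring, comm_monoid_mult} mat"
  assumes "n \<ge> 1"
    and "L \<in> carrier_mat n n"
    and "L * L = 0\<^sub>m n n"
  shows "infinitesimal_unitary_bialgebra
    (class_ring :: 'k ring) (mat_algebra n) 0 (mat_coproduct n L)"
proof -
  interpret unital_assoc_algebra "class_ring :: 'k ring" "mat_algebra n"
    by (rule unital_assoc_algebra_mat)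
  show ?thesis
    \<comment> \<open>Unfolding the record fields identifies the two hypotheses on \<open>L\<close>
      with those of the general result, and the weight with 0.\<close>
    using square_zero_bialgebra[of L] assms
    by (simp add: mat_coproduct_def[abs_def] mat_algebra_def)
qed

end
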